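(* Let $n\geq 1$ be an integer. (i) Almost surely there exists a (random) integer $M_0=M_0(n)\geq 0$ such that, for any integer $M\geq M_0$, there exists $t_0=t_0(n,M)\geq M$ such that, for any $t\geq t_0$, $$A_{n}[\infty]\cap \mathcal{H}_t = B_{n,M}(\infty)\cap \mathcal{H}_t.$$ (ii) The same property holds if $A_{n}[\infty]$ and $B_{n,M}(\infty)$ are replaced by $A_{n}^*[\infty]$ and $B_{n,M}^*(\infty)$ respectively.
   Context: Let $(S_{i,j})_{i\in\mathbb{Z},j\geq1}$ be independent simple symmetric random walks on $\mathbb{Z}^2$, $S_{i,j}$ starting at $(0,i)$. When the current aggregate is $A\subset\mathbb{Z}^2$, sending particle $(i,j)$ (from level $i$) means: follow $S_{i,j}$ until the first time (possibly time $0$) it is at a site $z\notin A$; the particle stops there and the aggregate becomes $A\cup\{z\}$. $A_n[M]$ ($M\geq0$) is the aggregate obtained from $\emptyset$ by sending the $n$ particles $(i,1),\dots,(i,n)$ from each level $i$ with $|i|\le M$, levels being treated in the usual order $0,1,-1,2,-2,\dots,M,-M$; $A_n[\infty]=\bigcup_{M\geq0}A_n[M]$ (increasing union). $B_{n,M}(M)=\emptyset$, and for an integer $t>M$, $B_{n,M}(t)$ is the aggregate obtained from $\emptyset$ by sending the $n$ particles of level $M+1$, then the $n$ particles of level $M+2$, and so on up to level $t$ included, using the same random walks as for $A_n[\infty]$; $B_{n,M}(\infty)=\bigcup_{t\geq M}B_{n,M}(t)$ (increasing union). Let $(N_i)_{i\in\mathbb{Z}}$ be i.i.d. Poisson random variables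 with parameter $n$, independent of the walks. $A_n^*[M]$, $A_n^*[\infty]$, $B^*_{n,M}(t)$, $B^*_{n,M}(\infty)$ are defined in the same way with $N_i$ particles $(i,1),\dots,(i,N_i)$ sent from level $i$ instead of $n$ (the same particles and walks being used for $A^*_n[\infty]$ and $B^*_{n,M}$). For an integer $K\geq0$, $\mathcal{H}_K=\{(x,y)\in\mathbb{Z}^2: y\geq K\}$. *)

theory Defs
  imports "HOL-Probability.Probability"
begin

type_synonym site = "int \<times> int"

definition unit_steps :: "site set" where
  "unit_steps = {(1, 0), (-1, 0), (0, 1), (0, -1)}"

definition simple_random_walk :: "'w measure \<Rightarrow> site \<Rightarrow> (nat \<Rightarrow> 'w \<Rightarrow> site) \<Rightarrow> bool" where
  "simple_random_walk P x X \<longleftrightarrow>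
     (\<forall>k. X k \<in> measurable P (count_space UNIV)) \<and>
     (AE \<omega> in P. X 0 \<omega> = x) \<and>
     prob_space.indep_vars P (\<lambda>_. count_space UNIV) (\<lambda>k \<omega>. X (Suc k) \<omega> - X k \<omega>) UNIV \<and>
     (\<forall>k. distr P (count_space UNIV) (\<lambda>\<omega>. X (Suc k) \<omega> - X k \<omega>)
          = measure_pmf (pmf_of_set unit_steps))"

definition particles :: "(int \<times> nat) set" where
  "particles = UNIV \<times> {1..}"

abbreviation path_space :: "(nat \<Rightarrow> site) measure" where
  "path_space \<equiv> (\<Pi>\<^sub>M k\<in>UNIV. count_space UNIV)"

text \<open>Particles are numbered from 1: nothing is assumed about \<open>S i 0\<close>, which is never used.\<close>

definition independent_walks :: "'w measure \<Rightarrow> (int \<Rightarrow> nat \<Rightarrow> nat \<Rightarrow> 'w \<Rightarrow> site) \<Rightarrow> bool" where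
  "independent_walks P S \<longleftrightarrow>
     (\<forall>(i, j)\<in>particles. simple_random_walk P (0, i) (S i j)) \<and>
     prob_space.indep_vars P (\<lambda>_. path_space) (\<lambda>(i, j) \<omega> k. S i j k \<omega>) particles"

text \<open>Independence of the counts from the walks is stated through the generated sigma-algebras,
  since \<^const>\<open>prob_space.indep_var\<close> requires both variables to have the same value type.\<close>

definition poisson_counts ::
  "'w measure \<Rightarrow> real \<Rightarrow> (int \<Rightarrow> nat \<Rightarrow> nat \<Rightarrow> 'w \<Rightarrow> site) \<Rightarrow> (int \<Rightarrow> 'w \<Rightarrow> nat) \<Rightarrow> bool" where
  "poisson_counts P r S N \<longleftrightarrow>
     prob_space.indep_vars P (\<lambda>_. count_space UNIV) N UNIV \<and>
     (\<forall>i. distr P (count_space UNIV) (N i) = measure_pmf (poisson_pmf r)) \<and>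
     prob_space.indep_set P
       (sets (vimage_algebra (space P) (\<lambda>\<omega> i. N i \<omega>) (\<Pi>\<^sub>M i\<in>UNIV. count_space UNIV)))
       (sets (vimage_algebra (space P) (\<lambda>\<omega>. \<lambda>(i, j)\<in>particles. \<lambda>k. S i j k \<omega>)
         (\<Pi>\<^sub>M p\<in>particles. path_space)))"

text \<open>A path that never leaves \<open>A\<close> leaves the aggregate unchanged; the aggregates below up to a
  finite level are finite, so for them this has probability zero.\<close>

definition send :: "(nat \<Rightarrow> site) \<Rightarrow> site set \<Rightarrow> site set" where
  "send w A = (if \<exists>k. w k \<notin> A then insert (w (LEAST k. w k \<notin> A)) A else A)"

text \<open>From here on, \<open>W i j\<close> is the path of particle \<open>(i, j)\<close> and \<open>c i\<close> is the number of
  particles sent from level \<open>i\<close>.\<close>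

definition send_level ::
  "(int \<Rightarrow> nat \<Rightarrow> nat \<Rightarrow> site) \<Rightarrow> (int \<Rightarrow> nat) \<Rightarrow> int \<Rightarrow> site set \<Rightarrow> site set" where
  "send_level W c i = fold (\<lambda>j. send (W i j)) [1..<Suc (c i)]"

primrec aggregate_A ::
  "(int \<Rightarrow> nat \<Rightarrow> nat \<Rightarrow> site) \<Rightarrow> (int \<Rightarrow> nat) \<Rightarrow> nat \<Rightarrow> site set" where
  "aggregate_A W c 0 = send_level W c 0 {}"
| "aggregate_A W c (Suc M) =
     send_level W c (- int (Suc M)) (send_level W c (int (Suc M)) (aggregate_A W c M))"

definition aggregate_A_inf ::
  "(int \<Rightarrow> nat \<Rightarrow> nat \<Rightarrow> site) \<Rightarrow> (int \<Rightarrow> nat) \<Rightarrow> site set" where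
  "aggregate_A_inf W c = (\<Union>M. aggregate_A W c M)"

definition aggregate_B ::
  "(int \<Rightarrow> nat \<Rightarrow> nat \<Rightarrow> site) \<Rightarrow> (int \<Rightarrow> nat) \<Rightarrow> nat \<Rightarrow> nat \<Rightarrow> site set" where
  "aggregate_B W c M t = fold (\<lambda>l. send_level W c (int l)) [Suc M..<Suc t] {}"

definition aggregate_B_inf ::
  "(int \<Rightarrow> nat \<Rightarrow> nat \<Rightarrow> site) \<Rightarrow> (int \<Rightarrow> nat) \<Rightarrow> nat \<Rightarrow> site set" where
  "aggregate_B_inf W c M = (\<Union>t\<in>{M..}. aggregate_B W c M t)"

definition half_plane :: "nat \<Rightarrow> site set" where
  "half_plane K = {(x, y). y \<ge> int K}"

end

theory Submission imports Defs begin

text \<open>Sending a particle preserves inclusion of aggregates, so \<open>B\<close> is always contained in \<open>A\<close>, and a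
  particle sent to both moves at most one site of the discrepancy \<open>A - B\<close>. Suppose that from some
  stage on no particle of level \<open>\<plusminus>(m + 1)\<close> reaches height \<open>0\<close> before it settles in \<open>A\<close>. Then the
  discrepancy at nonnegative heights no longer grows in cardinality: discrepancies may escape to
  infinity, but the limit set has at most as many sites, so it is finite and hence bounded.

  It remains to apply Borel--Cantelli. When a particle of level \<open>\<plusminus>(m + 1)\<close> is sent, the aggregate has
  \<open>O(m)\<close> sites, so at least half of the \<open>m + 1\<close> rows to be traversed contain at most a constant
  number of its sites. On each of those rows the walk leaves the aggregate with probability bounded
  below, by a straight horizontal run. Hence it reaches height \<open>0\<close> with probability exponentially
  small in \<open>m\<close>.\<close>

subsection \<open>Discrepancies between the aggregates\<close>

lemma send_cases:
  obtains "\<forall>k. w k \<in> A" "send w A = A"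
  | k where "w k \<notin> A" "\<forall>l<k. w l \<in> A" "send w A = insert (w k) A"
proof (cases "\<exists>k. w k \<notin> A")
  case True
  define k where "k = (LEAST k. w k \<notin> A)"
  have "w k \<notin> A" "\<forall>l<k. w l \<in> A"
    unfolding k_def using LeastI_ex[OF True] not_less_Least by blast+
  moreover have "send w A = insert (w k) A"
    using True by (simp add: send_def k_def)
  ultimately show ?thesis using that(2) by blast
next
  case False
  then show ?thesis using that(1) by (simp add: send_def)
qed

lemma subset_send: "A \<subseteq> send w A"
  by (auto simp: send_def)

text \<open>If \<open>w k\<close> is the first site of the walk outside \<open>B\<close>, then
  either \<open>w k\<close> already lies in \<open>A\<close>, or \<open>k\<close> is also the first
  exit time from \<open>A\<close>. Either way the larger aggregate ends up containing
  \<open>w k\<close>.\<close>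

lemma send_mono:
  assumes "B \<subseteq> A"
  shows "send w B \<subseteq> send w A"
proof (cases w B rule: send_cases)
  case 1
  then show ?thesis using assms subset_send by fastforce
next
  case (2 k)
  show ?thesis
  proof (cases w A rule: send_cases)
    case 1
    then show ?thesis using 2 assms by auto
  next
    case (2 k')
    have "w k \<in> send w A"
    proof (cases "w k \<in> A")
      case False
      then have "k = k'"
        using 2(1,2) \<open>\<forall>l<k. w l \<in> B\<close> assms by (metis linorder_neqE_nat subsetD)
      then show ?thesis using 2 by simp
    qed (use subset_send in blast)
    then show ?thesis using \<open>send w B = insert (w k) B\<close> assms subset_send[of A w] by auto
  qed
qed

lemma finite_send: "finite A \<Longrightarrow> finite (send w A)"
  by (simp add: send_def)

lemma card_send_le: "card (send w A) \<le> Suc (card A)"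
proof (cases "finite A")
  case True
  then show ?thesis by (simp add: send_def card_insert_if)
next
  case False
  then have "infinite (send w A)" using subset_send finite_subset by blast
  then show ?thesis by simp
qed

lemma finite_fold_send: "finite A \<Longrightarrow> finite (fold (\<lambda>j. send (w j)) js A)"
  by (induction js arbitrary: A) (simp_all add: finite_send)

lemma card_fold_send_le: "card (fold (\<lambda>j. send (w j)) js A) \<le> length js + card A"
proof (induction js arbitrary: A)
  case (Cons j js)
  show ?case using Cons[of "send (w j) A"] card_send_le[of "w j" A] by simp
qed simp

lemma fold_send_mono: "B \<subseteq> A \<Longrightarrow> fold (\<lambda>j. send (w j)) js B \<subseteq> fold (\<lambda>j. send (w j)) js A"
  by (induction js arbitrary: A B) (simp_all add: send_mono)

lemma subset_fold_send: "A \<subseteq> fold (\<lambda>j. send (w j)) js A"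
proof (induction js arbitrary: A)
  case (Cons j js)
  then show ?case using subset_send[of A "w j"] by fastforce
qed simp

text \<open>The sign \<open>s\<close> is the side of the starting level, so that both halves are
  treated at once. The position at time \<open>k\<close> itself is unconstrained: a walk whose first
  site outside \<open>G\<close> lies on or beyond the axis counts as crossing.\<close>

definition crosses :: "int \<Rightarrow> (nat \<Rightarrow> site) \<Rightarrow> site set \<Rightarrow> bool" where
  "crosses s w G \<longleftrightarrow> (\<exists>k. s * snd (w k) \<le> 0 \<and> (\<forall>l<k. w l \<in> G))"

text \<open>When the site gained by \<open>B\<close> already belongs to \<open>A\<close>, it leaves
  the discrepancy, and at most the site gained by \<open>A\<close> enters. Otherwise both aggregates
  gain the same site.\<close>

lemma card_discrepancy_send_both:
  assumes "finite A" "B \<subseteq> A" "\<not> crosses 1 w A"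
  shows "card ((send w A - send w B) \<inter> half_plane 0) \<le> card ((A - B) \<inter> half_plane 0)"
proof (cases w B rule: send_cases)
  case 1
  then have "\<forall>k. w k \<in> A" using assms by auto
  then have "send w A = A" by (simp add: send_def)
  then show ?thesis using 1 by simp
next
  case (2 k)
  have fin: "finite ((A - B) \<inter> half_plane 0)" using assms by auto
  have "\<forall>l<k. w l \<in> A" using 2 assms by auto
  \<comment> \<open>Without a crossing \<open>w k\<close> has positive height, so its removal is
    seen in the half plane and pays for the new site.\<close>
  then have high: "w k \<in> half_plane 0"
    using assms(3)[unfolded crosses_def not_ex, THEN spec, of k]
    by (simp add: half_plane_def case_prod_beta)
  show ?thesis
  proof (cases w A rule: send_cases)
    case 1
    then show ?thesis using 2 fin by (auto intro!: card_mono)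
  next
    case (2 k')
    show ?thesis
    proof (cases "w k \<in> A")
      case True
      have "(send w A - send w B) \<inter> half_plane 0
          \<subseteq> insert (w k') ((A - B) \<inter> half_plane 0 - {w k})"
        using 2 \<open>send w B = insert (w k) B\<close> by auto
      then have "card ((send w A - send w B) \<inter> half_plane 0)
          \<le> card (insert (w k') ((A - B) \<inter> half_plane 0 - {w k}))"
        using fin by (intro card_mono) auto
      also have "\<dots> \<le> Suc (card ((A - B) \<inter> half_plane 0 - {w k}))"
        using fin by (simp add: card_insert_if)
      also have "\<dots> = card ((A - B) \<inter> half_plane 0)"
        using fin high True \<open>w k \<notin> B\<close> by (intro card_Suc_Diff1) auto
      finally show ?thesis .
    next
      case False
      then have "k = k'"
        using 2(1,2) \<open>\<forall>l<k. w l \<in> A\<close> by (metis linorder_neqE_nat)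
      then show ?thesis
        using 2 \<open>send w B = insert (w k) B\<close> fin by (auto intro!: card_mono)
    qed
  qed
qed

text \<open>A particle from below that does not cross settles at negative height, where the half
  plane does not see it.\<close>

lemma card_discrepancy_send_one:
  assumes "finite A" "\<not> crosses (-1) w A"
  shows "card ((send w A - B) \<inter> half_plane 0) \<le> card ((A - B) \<inter> half_plane 0)"
proof (cases w A rule: send_cases)
  case (2 k)
  then have "w k \<notin> half_plane 0"
    using assms(2)[unfolded crosses_def not_ex, THEN spec, of k]
    by (simp add: half_plane_def case_prod_beta)
  then show ?thesis using 2 assms by (auto intro!: card_mono)
qed simp

lemma card_discrepancy_fold_both:
  assumes "finite A" "B \<subseteq> A"
    and "\<And>j. j \<in> {1..n} \<Longrightarrow> \<not> crosses 1 (w j) (fold (\<lambda>j. send (w j)) [1..<j] A)"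
  shows "card ((fold (\<lambda>j. send (w j)) [1..<Suc n] A - fold (\<lambda>j. send (w j)) [1..<Suc n] B)
             \<inter> half_plane 0) \<le> card ((A - B) \<inter> half_plane 0)"
  using assms(3)
proof (induction n)
  case (Suc n)
  have "[1..<Suc (Suc n)] = [1..<Suc n] @ [Suc n]" by simp
  moreover have "\<not> crosses 1 (w (Suc n)) (fold (\<lambda>j. send (w j)) [1..<Suc n] A)"
    by (rule Suc.prems) simp
  note card_discrepancy_send_both[OF finite_fold_send[OF assms(1)] fold_send_mono[OF assms(2)] this]
  moreover note Suc.IH[OF Suc.prems]
  ultimately show ?case by (simp del: upt_Suc)
qed simp

lemma card_discrepancy_fold_one:
  assumes "finite A"
    and "\<And>j. j \<in> {1..n} \<Longrightarrow> \<not> crosses (-1) (w j) (fold (\<lambda>j. send (w j)) [1..<j] A)"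
  shows "card ((fold (\<lambda>j. send (w j)) [1..<Suc n] A - B) \<inter> half_plane 0)
       \<le> card ((A - B) \<inter> half_plane 0)"
  using assms(2)
proof (induction n)
  case (Suc n)
  have "[1..<Suc (Suc n)] = [1..<Suc n] @ [Suc n]" by simp
  moreover have "\<not> crosses (-1) (w (Suc n)) (fold (\<lambda>j. send (w j)) [1..<Suc n] A)"
    by (rule Suc.prems) simp
  note card_discrepancy_send_one[OF finite_fold_send[OF assms(1)] this, of B]
  moreover note Suc.IH[OF Suc.prems]
  ultimately show ?case by (simp del: upt_Suc)
qed simp

lemma finite_aggregate_A: "finite (aggregate_A W c m)"
  by (induction m) (simp_all add: send_level_def finite_fold_send del: upt_Suc)

lemma aggregate_A_mono: "m \<le> m' \<Longrightarrow> aggregate_A W c m \<subseteq> aggregate_A W c m'"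
proof (rule lift_Suc_mono_le[of "aggregate_A W c"])
  show "aggregate_A W c m \<subseteq> aggregate_A W c (Suc m)" for m
    unfolding aggregate_A.simps send_level_def
    by (rule order_trans[OF subset_fold_send subset_fold_send])
qed

lemma aggregate_B_Suc:
  "M \<le> t \<Longrightarrow> aggregate_B W c M (Suc t) = send_level W c (int (Suc t)) (aggregate_B W c M t)"
  by (simp add: aggregate_B_def)

lemma aggregate_B_subset_A: "aggregate_B W c M t \<subseteq> aggregate_A W c t"
proof (induction t)
  case (Suc t)
  show ?case
  proof (cases "M \<le> t")
    case True
    show ?thesis
      unfolding aggregate_B_Suc[OF True] aggregate_A.simps send_level_def
      by (rule order_trans[OF fold_send_mono[OF Suc] subset_fold_send])
  qed (simp add: aggregate_B_def)
qed (simp add: aggregate_B_def)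

text \<open>The aggregate of the process \<open>A\<close> just before particle \<open>j\<close> of level \<open>s (m + 1)\<close> is sent,
  where \<open>s\<close> is a sign.\<close>

definition before ::
  "(int \<Rightarrow> nat \<Rightarrow> nat \<Rightarrow> site) \<Rightarrow> (int \<Rightarrow> nat) \<Rightarrow> nat \<Rightarrow> int \<Rightarrow> nat \<Rightarrow> site set" where
  "before W c m s j = fold (\<lambda>j. send (W (s * int (Suc m)) j)) [1..<j]
     (if s = 1 then aggregate_A W c m else send_level W c (int (Suc m)) (aggregate_A W c m))"

definition calm :: "(int \<Rightarrow> nat \<Rightarrow> nat \<Rightarrow> site) \<Rightarrow> (int \<Rightarrow> nat) \<Rightarrow> nat \<Rightarrow> bool" where
  "calm W c m \<longleftrightarrow> (\<forall>s\<in>{1, -1}. \<forall>j\<in>{1..c (s * int (Suc m))}.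
     \<not> crosses s (W (s * int (Suc m)) j) (before W c m s j))"

lemma card_discrepancy_Suc:
  assumes "calm W c m" "M \<le> m"
  shows "card ((aggregate_A W c (Suc m) - aggregate_B W c M (Suc m)) \<inter> half_plane 0)
       \<le> card ((aggregate_A W c m - aggregate_B W c M m) \<inter> half_plane 0)"
proof -
  let ?A = "aggregate_A W c m" and ?B = "aggregate_B W c M m"
  let ?A' = "send_level W c (int (Suc m)) ?A" and ?B' = "send_level W c (int (Suc m)) ?B"
  have "card ((send_level W c (- int (Suc m)) ?A' - ?B') \<inter> half_plane 0)
      \<le> card ((?A' - ?B') \<inter> half_plane 0)"
    unfolding send_level_def[of W c "- int (Suc m)"]
    using assms(1)[unfolded calm_def, THEN bspec, of "-1"]
    by (intro card_discrepancy_fold_one)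
      (auto simp: before_def send_level_def finite_aggregate_A finite_fold_send simp del: upt_Suc of_nat_Suc)
  also have "\<dots> \<le> card ((?A - ?B) \<inter> half_plane 0)"
    unfolding send_level_def
    using assms(1)[unfolded calm_def, THEN bspec, of 1] aggregate_B_subset_A[of W c M m]
    by (intro card_discrepancy_fold_both)
      (auto simp: before_def finite_aggregate_A simp del: upt_Suc of_nat_Suc)
  finally show ?thesis unfolding aggregate_B_Suc[OF assms(2)] aggregate_A.simps .
qed

text \<open>Whatever the levels before \<open>m0\<close> do, the discrepancy at stage
  \<open>max m0 M\<close> is finite, and from then on its size cannot grow. Hence \<open>M\<close>
  may be arbitrary.\<close>

lemma aggregates_agree_if_calm:
  assumes "\<And>m. m \<ge> m0 \<Longrightarrow> calm W c m"
  shows "\<exists>t0\<ge>M. \<forall>t\<ge>t0. aggregate_A_inf W c \<inter> half_plane t = aggregate_B_inf W c M \<inter> half_plane t"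
proof -
  define D where "D m = (aggregate_A W c m - aggregate_B W c M m) \<inter> half_plane 0" for m
  define E where "E = (aggregate_A_inf W c - aggregate_B_inf W c M) \<inter> half_plane 0"
  define m1 where "m1 = max m0 M"
  have D_bound: "card (D m) \<le> card (D m1)" if "m \<ge> m1" for m
    using that
  proof (induction m rule: dec_induct)
    case (step m)
    then show ?case
      using card_discrepancy_Suc[OF assms, of m M] by (auto simp: D_def m1_def)
  qed simp
  \<comment> \<open>The sets \<open>D m\<close> need not increase, so the bound is carried to the
    limit through finite subsets \<open>F\<close> of \<open>E\<close>: each site of \<open>F\<close>
    has entered \<open>A\<close> by some stage and never enters \<open>B\<close>, so all of
    \<open>F\<close> lies in a single \<open>D m\<close>.\<close>
  have "card F \<le> card (D m1)" if F: "F \<subseteq> E" "finite F" for F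
  proof -
    have "\<exists>m. z \<in> aggregate_A W c m" if "z \<in> F" for z
      using that F by (auto simp: E_def aggregate_A_inf_def)
    then obtain g where g: "\<And>z. z \<in> F \<Longrightarrow> z \<in> aggregate_A W c (g z)" by metis
    define m where "m = Max (insert m1 (g ` F))"
    have m: "m \<ge> m1" "\<And>z. z \<in> F \<Longrightarrow> g z \<le> m" using F by (auto simp: m_def)
    have "F \<subseteq> D m"
    proof
      fix z assume z: "z \<in> F"
      then have "z \<in> aggregate_A W c m" using g m aggregate_A_mono by blast
      moreover have "z \<notin> aggregate_B W c M m" "z \<in> half_plane 0"
        using z F m by (auto simp: E_def aggregate_B_inf_def m1_def)
      ultimately show "z \<in> D m" by (simp add: D_def)
    qed
    then have "card F \<le> card (D m)"
      by (rule card_mono[rotated]) (simp add: D_def finite_aggregate_A)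
    then show ?thesis using D_bound[OF m(1)] by simp
  qed
  then have fin: "finite E" by (meson finite_if_finite_subsets_card_bdd)
  \<comment> \<open>The \<open>Suc\<close> puts \<open>t0\<close> strictly above every site of
    \<open>E\<close>; inserting \<open>M\<close> gives \<open>t0 \<ge> M\<close> and keeps
    \<open>Max\<close> meaningful when \<open>E\<close> is empty.\<close>
  define t0 where "t0 = Max (insert M ((\<lambda>z. Suc (nat (snd z))) ` E))"
  have t0: "t0 \<ge> M" "\<And>z. z \<in> E \<Longrightarrow> Suc (nat (snd z)) \<le> t0"
    using fin by (auto simp: t0_def)
  have sub: "aggregate_B_inf W c M \<subseteq> aggregate_A_inf W c"
    using aggregate_B_subset_A by (fastforce simp: aggregate_B_inf_def aggregate_A_inf_def)
  have "z \<in> aggregate_B_inf W c M"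
    if "t \<ge> t0" "z \<in> aggregate_A_inf W c" "z \<in> half_plane t" for t z
  proof (rule ccontr)
    assume "z \<notin> aggregate_B_inf W c M"
    then have "z \<in> E" using that by (auto simp: E_def half_plane_def)
    then show False using t0(2) that by (force simp: half_plane_def)
  qed
  then show ?thesis using t0(1) sub by blast
qed

subsection \<open>Walks confined to a finite set\<close>

definition thin :: "nat \<Rightarrow> site set \<Rightarrow> int \<Rightarrow> bool" where
  "thin L G y \<longleftrightarrow> card {x. (x, y) \<in> G} \<le> L"

definition thin_rows :: "int \<Rightarrow> nat \<Rightarrow> site set \<Rightarrow> int \<Rightarrow> nat" where
  "thin_rows s L G y = card {v\<in>{1..y}. thin L G (s * v)}"

lemma thin_rows_mono: "y \<le> y' \<Longrightarrow> thin_rows s L G y \<le> thin_rows s L G y'"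
  unfolding thin_rows_def
  by (intro card_mono) (auto intro: finite_subset[of _ "{1..y'}"])

lemma thin_rows_step:
  assumes "y \<ge> 1"
  shows "thin_rows s L G y = thin_rows s L G (y - 1) + (if thin L G (s * y) then 1 else 0)"
proof -
  have *: "{v\<in>{1..y}. thin L G (s * v)}
      = {v\<in>{1..y - 1}. thin L G (s * v)} \<union> (if thin L G (s * y) then {y} else {})"
    using assms by (auto simp: le_less)
  then show ?thesis
    unfolding thin_rows_def *
    by (subst card_Un_disjoint) (auto intro: finite_subset[of _ "{1..y}"])
qed

text \<open>A row that is not thin holds more than \<open>2 * C\<close> of the at most
  \<open>C * k\<close> sites, so at most half of the \<open>k\<close> rows fail to be thin.\<close>

lemma thin_rows_ge:
  assumes "finite G" "s \<in> {1, -1}" "card G \<le> C * k"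
  shows "k \<le> 2 * thin_rows s (2 * C) G (int k)"
\<comment> \<open>The general count cancels \<open>C\<close>; for \<open>C = 0\<close> the set is
  empty and every row is thin.\<close>
proof (cases "C = 0")
  case True
  then have "G = {}" using assms by simp
  moreover have "{v\<in>{1..int k}. thin (2 * C) {} (s * v)} = {1..int k}"
    by (auto simp: thin_def)
  ultimately show ?thesis by (simp add: thin_rows_def)
next
  case False
  define T where "T = {v\<in>{1..int k}. thin (2 * C) G (s * v)}"
  define K where "K = {v\<in>{1..int k}. \<not> thin (2 * C) G (s * v)}"
  have row: "finite {x. (x, y) \<in> G}" for y
    by (rule finite_subset[OF _ finite_imageI[OF assms(1), of fst]]) force
  have "card K * (2 * C) \<le> (\<Sum>v\<in>K. card {x. (x, s * v) \<in> G})"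
    using sum_bounded_below[of K "2 * C" "\<lambda>v. card {x. (x, s * v) \<in> G}"]
    by (auto simp: K_def thin_def)
  also have "\<dots> = card (SIGMA v:K. {x. (x, s * v) \<in> G})"
    using row by (subst card_SigmaI) (auto simp: K_def intro: finite_subset[of _ "{1..int k}"])
  also have "\<dots> \<le> card G"
    using assms(1,2) by (intro card_inj_on_le[of "\<lambda>(v, x). (x, s * v)"]) (auto simp: inj_on_def)
  finally have "card K * 2 \<le> k" using False assms(3) by (simp add: algebra_simps)
    (metis mult_le_cancel1 mult.left_commute mult.commute order_trans neq0_conv)
  moreover have "card T + card K = k"
  proof -
    have "{1..int k} = T \<union> K" "T \<inter> K = {}" "finite T" "finite K"
      by (auto simp: T_def K_def intro: finite_subset[of _ "{1..int k}"])
    moreover have "card {1..int k} = k" by simp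
    ultimately show ?thesis using card_Un_disjoint[of T K] by simp
  qed
  ultimately show ?thesis by (simp add: thin_rows_def T_def)
qed

text \<open>A superharmonic majorant of the probability that the walk started at \<open>z\<close> reaches the axis
  inside \<open>G\<close>. On a thin row the walk escapes from \<open>G\<close> by going straight to the right, which it
  does with probability at least \<open>4\<^sup>-\<^sup>L\<close>.\<close>

definition gap :: "site set \<Rightarrow> site \<Rightarrow> nat" where
  "gap G z = (LEAST d. (fst z + int d, snd z) \<notin> G)"

definition majorant :: "int \<Rightarrow> nat \<Rightarrow> site set \<Rightarrow> site \<Rightarrow> real" where
  "majorant s L G z =
    (if s * snd z \<le> 0 then 1 else if z \<notin> G then 0
     else if thin L G (snd z)
       then (1 - (1/4) ^ gap G z) * (1 - (1/4) ^ L) ^ thin_rows s L G (s * snd z - 1)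
       else (1 - (1/4) ^ L) ^ thin_rows s L G (s * snd z))"

text \<open>Rows of a finite set are finite, so the run to the right does leave \<open>G\<close>,
  and the sites it passes before that are distinct sites of one row.\<close>

lemma
  assumes "finite G"
  shows gap_notin: "(fst z + int (gap G z), snd z) \<notin> G"
    and gap_le: "thin L G (snd z) \<Longrightarrow> gap G z \<le> L"
proof -
  have row: "finite {x. (x, snd z) \<in> G}"
    by (rule finite_subset[OF _ finite_imageI[OF assms, of fst]]) force
  have "\<exists>d. (fst z + int d, snd z) \<notin> G"
  proof (rule ccontr)
    assume "\<not> ?thesis"
    then have "range (\<lambda>d. fst z + int d) \<subseteq> {x. (x, snd z) \<in> G}" by auto
    then have "finite (range (\<lambda>d. fst z + int d))" using row finite_subset by blast
    then show False by (subst (asm) finite_image_iff) (auto simp: inj_on_def)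
  qed
  from LeastI_ex[OF this] show "(fst z + int (gap G z), snd z) \<notin> G" by (simp add: gap_def)
  have inG: "(fst z + int d, snd z) \<in> G" if "d < gap G z" for d
    using that not_less_Least unfolding gap_def by blast
  have "gap G z = card ((\<lambda>d. fst z + int d) ` {..<gap G z})"
    by (subst card_image) (auto simp: inj_on_def)
  also have "\<dots> \<le> card {x. (x, snd z) \<in> G}"
    using inG row by (intro card_mono) auto
  finally show "thin L G (snd z) \<Longrightarrow> gap G z \<le> L" by (simp add: thin_def)
qed

lemma gap_right:
  assumes "finite G" "z \<in> G"
  shows "gap G z = Suc (gap G (z + (1, 0)))"
proof -
  have "gap G z = Suc (LEAST d. (fst z + int (Suc d), snd z) \<notin> G)"
    unfolding gap_def using gap_notin[OF assms(1), of z] assms(2)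
    by (intro Least_Suc) auto
  then show ?thesis by (simp add: gap_def add.assoc)
qed

lemma gap_outside: "z \<notin> G \<Longrightarrow> gap G z = 0"
  by (simp add: gap_def Least_eq_0)

lemma base_bounds: "0 \<le> 1 - (1/4::real) ^ L" "1 - (1/4::real) ^ L \<le> 1"
  by (simp_all add: power_le_one)

lemma majorant_nonneg: "majorant s L G z \<ge> 0"
  using base_bounds by (simp add: majorant_def)

text \<open>The position within the row is discarded: on a thin row the gap is at most
  \<open>L\<close>, which turns the first factor into one more power of the base, accounting for the
  row of \<open>z\<close> itself.\<close>

lemma majorant_le:
  assumes "finite G" "s \<in> {1, -1}"
  shows "majorant s L G z \<le> (1 - (1/4) ^ L) ^ thin_rows s L G (s * snd z)"
proof -
  let ?y = "s * snd z" and ?\<rho> = "1 - (1/4::real) ^ L"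
  consider "?y \<le> 0" | "?y > 0" "z \<notin> G" | "?y > 0" "z \<in> G" "\<not> thin L G (snd z)"
    | "?y > 0" "z \<in> G" "thin L G (snd z)" by linarith
  then show ?thesis
  proof cases
    case 1
    then show ?thesis by (simp add: majorant_def thin_rows_def)
  next
    case 2
    then show ?thesis using base_bounds by (simp add: majorant_def)
  next
    case 3
    then show ?thesis by (simp add: majorant_def)
  next
    case 4
    have row: "s * ?y = snd z" using assms(2) by auto
    have "1 - (1/4) ^ gap G z \<le> ?\<rho>"
      using gap_le[OF assms(1) 4(3)] by (simp add: power_decreasing)
    then have "majorant s L G z \<le> ?\<rho> * ?\<rho> ^ thin_rows s L G (?y - 1)"
      using 4 base_bounds by (simp add: majorant_def mult_right_mono)
    then show ?thesis using thin_rows_step[of ?y s L G] 4 row by simp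
  qed
qed

text \<open>On a thin row the right neighbour has a gap smaller by one, and
  \<open>(1 - 4 * q) + 3 = 4 * (1 - q)\<close> with \<open>q = (1/4) ^ gap G z\<close> absorbs the
  crude bound at the other three neighbours. On any other row, the row of \<open>z\<close> adds
  nothing to the count, so the bound \<open>near\<close> on each neighbour equals the value at
  \<open>z\<close>.\<close>

lemma majorant_superharmonic:
  assumes "finite G" "s \<in> {1, -1}" "s * snd z > 0" "z \<in> G"
  shows "(\<Sum>e\<in>unit_steps. majorant s L G (z + e)) \<le> 4 * majorant s L G z"
proof -
  let ?y = "s * snd z" and ?\<rho> = "1 - (1/4::real) ^ L" and ?h = "majorant s L G"
  have row: "s * ?y = snd z" using assms(2) by auto
  have near: "?h (z + e) \<le> ?\<rho> ^ thin_rows s L G (?y - 1)" if "e \<in> unit_steps" for e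
  proof -
    have "?y - 1 \<le> s * snd (z + e)"
      using that assms(2) by (auto simp: unit_steps_def algebra_simps)
    then have "?\<rho> ^ thin_rows s L G (s * snd (z + e)) \<le> ?\<rho> ^ thin_rows s L G (?y - 1)"
      using base_bounds by (intro power_decreasing thin_rows_mono) auto
    then show ?thesis using majorant_le[OF assms(1,2), of L "z + e"] by linarith
  qed
  have split: "(\<Sum>e\<in>unit_steps. ?h (z + e))
      = ?h (z + (1,0)) + ?h (z + (-1,0)) + ?h (z + (0,1)) + ?h (z + (0,-1))"
    by (simp add: unit_steps_def)
  show ?thesis
  proof (cases "thin L G (snd z)")
    case True
    let ?r = "?\<rho> ^ thin_rows s L G (?y - 1)"
    \<comment> \<open>If the right neighbour is outside \<open>G\<close>, its gap is 0 and the
      right-hand side vanishes, so one formula covers both cases.\<close>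
    have "?h (z + (1,0)) \<le> (1 - (1/4) ^ gap G (z + (1,0))) * ?r"
      using True assms(3) by (simp add: majorant_def gap_outside)
    then have "(\<Sum>e\<in>unit_steps. ?h (z + e)) \<le> (1 - (1/4) ^ gap G (z + (1,0))) * ?r + ?r + ?r + ?r"
      unfolding split by (intro add_mono near) (auto simp: unit_steps_def)
    also have "\<dots> = 4 * ((1 - (1/4) ^ gap G z) * ?r)"
      unfolding gap_right[OF assms(1,4)] by (simp add: algebra_simps)
    also have "\<dots> = 4 * ?h z" using True assms by (simp add: majorant_def)
    finally show ?thesis .
  next
    case False
    have "thin_rows s L G (?y - 1) = thin_rows s L G ?y"
      using thin_rows_step[of ?y s L G] False assms(3) row by simp
    then have "?h z = ?\<rho> ^ thin_rows s L G (?y - 1)"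
      using False assms by (simp add: majorant_def)
    moreover have "(\<Sum>e\<in>unit_steps. ?h (z + e))
        \<le> (\<Sum>e\<in>unit_steps. ?\<rho> ^ thin_rows s L G (?y - 1))"
      by (intro sum_mono near)
    ultimately show ?thesis by (simp add: unit_steps_def)
  qed
qed

section \<open>Counting the step sequences that cross\<close>

fun steps_cross :: "int \<Rightarrow> site set \<Rightarrow> site \<Rightarrow> site list \<Rightarrow> bool" where
  "steps_cross s G z [] \<longleftrightarrow> s * snd z \<le> 0"
| "steps_cross s G z (e # es) \<longleftrightarrow> s * snd z \<le> 0 \<or> z \<in> G \<and> steps_cross s G (z + e) es"

text \<open>Divided by \<open>4 ^ T\<close>, this is the supermartingale bound for the stopped walk,
  obtained by splitting off the first step. A list that has reached the axis continues freely, which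
  keeps all lists at length \<open>T\<close> and their weights equal.\<close>

lemma card_steps_cross_le:
  assumes "finite G" "s \<in> {1, -1}"
  shows "real (card {es. set es \<subseteq> unit_steps \<and> length es = T \<and> steps_cross s G z es})
       \<le> 4 ^ T * majorant s L G z"
proof (induction T arbitrary: z)
  case 0
  have "{es. set es \<subseteq> unit_steps \<and> length es = 0 \<and> steps_cross s G z es}
      = (if s * snd z \<le> 0 then {[]} else {})" by auto
  moreover have "majorant s L G z = 1" if "s * snd z \<le> 0"
    using that by (simp add: majorant_def)
  ultimately show ?case using majorant_nonneg[of s L G z] by auto
next
  case (Suc T)
  let ?Q = "\<lambda>T z. {es. set es \<subseteq> unit_steps \<and> length es = T \<and> steps_cross s G z es}"
  have fu: "finite unit_steps" "card unit_steps = 4" by (simp_all add: unit_steps_def)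
  have fin: "finite (?Q T z)" for T z
    by (rule finite_subset[OF _ finite_lists_length_eq[OF fu(1), of T]]) auto
  show ?case
  proof (cases "s * snd z \<le> 0")
    case True
    have "card (?Q (Suc T) z) \<le> card {es. set es \<subseteq> unit_steps \<and> length es = Suc T}"
      by (intro card_mono finite_lists_length_eq fu) auto
    also have "\<dots> = 4 ^ Suc T" using card_lists_length_eq[OF fu(1)] fu by simp
    finally have "real (card (?Q (Suc T) z)) \<le> 4 ^ Suc T"
      using of_nat_mono by fastforce
    then show ?thesis using True by (simp add: majorant_def)
  next
    case False
    show ?thesis
    proof (cases "z \<in> G")
      case True
      have "?Q (Suc T) z \<subseteq> (\<Union>e\<in>unit_steps. (#) e ` ?Q T (z + e))"
      proof
        fix es assume es: "es \<in> ?Q (Suc T) z"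
        then obtain e es' where "es = e # es'" by (cases es) auto
        then show "es \<in> (\<Union>e\<in>unit_steps. (#) e ` ?Q T (z + e))"
          using es False by auto
      qed
      then have "card (?Q (Suc T) z) \<le> card (\<Union>e\<in>unit_steps. (#) e ` ?Q T (z + e))"
        using fin fu by (intro card_mono) auto
      also have "\<dots> \<le> (\<Sum>e\<in>unit_steps. card ((#) e ` ?Q T (z + e)))"
        using fu by (intro card_UN_le) auto
      also have "\<dots> = (\<Sum>e\<in>unit_steps. card (?Q T (z + e)))"
        by (intro sum.cong card_image) auto
      finally have "real (card (?Q (Suc T) z)) \<le> (\<Sum>e\<in>unit_steps. real (card (?Q T (z + e))))"
        by (simp flip: of_nat_sum)
      also have "\<dots> \<le> (\<Sum>e\<in>unit_steps. 4 ^ T * majorant s L G (z + e))"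
        by (intro sum_mono Suc.IH)
      also have "\<dots> = 4 ^ T * (\<Sum>e\<in>unit_steps. majorant s L G (z + e))"
        by (simp add: sum_distrib_left)
      also have "\<dots> \<le> 4 ^ T * (4 * majorant s L G z)"
        using majorant_superharmonic[OF assms _ True] False by (intro mult_left_mono) auto
      finally show ?thesis by simp
    next
      case False
      then have "steps_cross s G z es \<Longrightarrow> s * snd z \<le> 0" for es by (cases es) auto
      then have "?Q (Suc T) z = {}" using \<open>\<not> s * snd z \<le> 0\<close> by auto
      then show ?thesis by (simp only: card.empty) (simp add: majorant_nonneg)
    qed
  qed
qed

subsection \<open>Crossing probabilities\<close>

lemma crosses_upto_iff_steps_cross:
  "(\<exists>k\<le>T. s * snd (w k) \<le> 0 \<and> (\<forall>l<k. w l \<in> G))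
     \<longleftrightarrow> steps_cross s G (w 0) (map (\<lambda>k. w (Suc k) - w k) [0..<T])"
proof (induction T arbitrary: w)
  case (Suc T)
  have "(\<exists>k\<le>Suc T. s * snd (w k) \<le> 0 \<and> (\<forall>l<k. w l \<in> G))
     \<longleftrightarrow> s * snd (w 0) \<le> 0 \<or> (\<exists>k\<le>T. s * snd (w (Suc k)) \<le> 0 \<and> (\<forall>l<Suc k. w l \<in> G))"
    (is "?L \<longleftrightarrow> ?R")
  proof
    assume ?L
    then obtain k where k: "k \<le> Suc T" "s * snd (w k) \<le> 0" "\<forall>l<k. w l \<in> G" by blast
    then show ?R by (cases k) auto
  next
    assume ?R
    then show ?L by (metis Suc_le_mono le0 not_less_zero)
  qed
  also have "\<dots> \<longleftrightarrow> s * snd (w 0) \<le> 0 \<or> w 0 \<in> G \<and>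
      (\<exists>k\<le>T. s * snd (w (Suc k)) \<le> 0 \<and> (\<forall>l<k. w (Suc l) \<in> G))"
    by (auto simp: All_less_Suc2)
  finally show ?case
    unfolding map_upt_Suc using Suc.IH[of "\<lambda>k. w (Suc k)"] by simp
qed simp

lemma measurable_discrete_compose:
  "X \<in> measurable M (count_space UNIV) \<Longrightarrow> (\<lambda>x. f (X x)) \<in> measurable M (count_space UNIV)"
  by (rule measurable_compose[OF _ measurable_count_space])

lemma pred_crosses:
  assumes "\<And>k. (\<lambda>x. X x k) \<in> measurable M (count_space UNIV)"
  shows "Measurable.pred M (\<lambda>x. crosses s (X x) G)"
proof -
  have [measurable]: "Measurable.pred M (\<lambda>x. s * snd (X x k) \<le> 0)" "Measurable.pred M (\<lambda>x. X x k \<in> G)" for k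
    using assms by (rule measurable_discrete_compose)+
  show ?thesis unfolding crosses_def by measurable
qed

text \<open>Crossing by time \<open>T\<close> is decided by the first \<open>T\<close> increments,
  and each list of \<open>T\<close> unit steps has probability \<open>(1/4) ^ T\<close>. So the
  count of crossing lists bounds the probability uniformly in \<open>T\<close>, and continuity from
  below removes the horizon.\<close>

lemma (in prob_space) prob_crosses_le:
  assumes walk: "simple_random_walk M x X" and G: "finite G" and s: "s \<in> {1, -1}"
  shows "prob {\<omega>\<in>space M. crosses s (\<lambda>k. X k \<omega>) G} \<le> majorant s L G x"
proof -
  define \<xi> where "\<xi> k \<omega> = X (Suc k) \<omega> - X k \<omega>" for k \<omega>
  have X: "X k \<in> measurable M (count_space UNIV)" for k
    using walk by (simp add: simple_random_walk_def)
  have start: "AE \<omega> in M. X 0 \<omega> = x"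
    using walk by (simp add: simple_random_walk_def)
  have indep: "indep_vars (\<lambda>_. count_space UNIV) \<xi> UNIV"
    using walk by (simp add: simple_random_walk_def \<xi>_def[abs_def])
  have \<xi>: "\<xi> k \<in> measurable M (count_space UNIV)" for k
    using indep by (simp add: indep_vars_def)
  have distr: "distr M (count_space UNIV) (\<xi> k) = measure_pmf (pmf_of_set unit_steps)" for k
    using walk by (simp add: simple_random_walk_def \<xi>_def[abs_def])
  have fu: "finite unit_steps" "unit_steps \<noteq> {}" "card unit_steps = 4"
    by (simp_all add: unit_steps_def)
  have "AE \<omega> in M. \<xi> k \<omega> \<in> unit_steps" for k
  proof (rule AE_distrD[OF \<xi>])
    show "AE e in distr M (count_space UNIV) (\<xi> k). e \<in> unit_steps"
      unfolding distr using fu by (simp add: AE_measure_pmf_iff)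
  qed
  then have steps: "AE \<omega> in M. \<forall>k. \<xi> k \<omega> \<in> unit_steps"
    by (simp add: AE_all_countable)
  have prob_step: "prob (\<xi> k -` {e} \<inter> space M) = 1/4" if "e \<in> unit_steps" for k e
    using measure_distr[OF \<xi>, of "{e}" k] that by (simp add: distr measure_pmf_single fu)
  have prob_steps: "prob {\<omega>\<in>space M. \<forall>k<T. \<xi> k \<omega> = es ! k} = (1/4) ^ T"
    if "set es \<subseteq> unit_steps" "length es = T" for es T
  \<comment> \<open>The product rule for independent variables is applied to a nonempty set of
    times.\<close>
  proof (cases "T = 0")
    case False
    have "{\<omega>\<in>space M. \<forall>k<T. \<xi> k \<omega> = es ! k} = (\<Inter>k\<in>{..<T}. \<xi> k -` {es ! k} \<inter> space M)"
      using False by auto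
    moreover have "prob (\<Inter>k\<in>{..<T}. \<xi> k -` {es ! k} \<inter> space M)
        = (\<Prod>k\<in>{..<T}. prob (\<xi> k -` {es ! k} \<inter> space M))"
      using False by (intro indep_varsD[OF indep]) auto
    moreover have "\<dots> = (\<Prod>k\<in>{..<T}. 1/4)"
      using that by (intro prod.cong prob_step) auto
    ultimately show ?thesis by simp
  qed (simp add: prob_space)
  define C where "C T = {\<omega>\<in>space M. \<exists>k\<le>T. s * snd (X k \<omega>) \<le> 0 \<and> (\<forall>l<k. X l \<omega> \<in> G)}" for T
  have [measurable]: "Measurable.pred M (\<lambda>\<omega>. s * snd (X k \<omega>) \<le> 0)" "Measurable.pred M (\<lambda>\<omega>. X k \<omega> \<in> G)" for k
    using X by (rule measurable_discrete_compose)+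
  have C: "C T \<in> events" for T unfolding C_def by measurable
  have C_le: "prob (C T) \<le> majorant s L G x" for T
  proof -
    let ?Q = "{es. set es \<subseteq> unit_steps \<and> length es = T \<and> steps_cross s G x es}"
    define E where "E es = {\<omega>\<in>space M. \<forall>k<T. \<xi> k \<omega> = es ! k}" for es
    have finQ: "finite ?Q"
      by (rule finite_subset[OF _ finite_lists_length_eq[OF fu(1), of T]]) auto
    have E: "E es \<in> events" for es
    proof -
      have [measurable]: "Measurable.pred M (\<lambda>\<omega>. \<xi> k \<omega> = es ! k)" for k
        using \<xi> by (rule measurable_discrete_compose)
      show ?thesis unfolding E_def by measurable
    qed
    have "prob (C T) \<le> prob (\<Union>es\<in>?Q. E es)"
    \<comment> \<open>The inclusion is an almost sure one: the starting point and the range of the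
      increments are prescribed only almost surely.\<close>
    proof (rule finite_measure_mono_AE)
      show "AE \<omega> in M. \<omega> \<in> C T \<longrightarrow> \<omega> \<in> (\<Union>es\<in>?Q. E es)"
        using start steps
      proof eventually_elim
        case (elim \<omega>)
        show ?case
        proof
          assume \<omega>: "\<omega> \<in> C T"
          then have "steps_cross s G x (map (\<lambda>k. \<xi> k \<omega>) [0..<T])"
            using crosses_upto_iff_steps_cross[of T s "\<lambda>k. X k \<omega>" G] elim(1)
            by (simp add: C_def \<xi>_def)
          then show "\<omega> \<in> (\<Union>es\<in>?Q. E es)"
            using elim(2) \<omega> by (intro UN_I[of "map (\<lambda>k. \<xi> k \<omega>) [0..<T]"]) (auto simp: C_def E_def)
        qed
      qed
    qed (rule sets.finite_UN[OF finQ E])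
    also have "\<dots> \<le> (\<Sum>es\<in>?Q. prob (E es))"
      using E by (intro finite_measure_subadditive_finite[OF finQ]) blast
    also have "\<dots> = (\<Sum>es\<in>?Q. (1/4) ^ T)"
    proof (rule sum.cong)
      fix es assume "es \<in> ?Q"
      then show "prob (E es) = (1/4) ^ T" unfolding E_def by (intro prob_steps) blast+
    qed simp
    also have "\<dots> = real (card ?Q) * (1/4) ^ T" by simp
    also have "\<dots> \<le> 4 ^ T * majorant s L G x * (1/4) ^ T"
      by (intro mult_right_mono card_steps_cross_le G s) auto
    also have "\<dots> = majorant s L G x" by (simp add: power_divide)
    finally show ?thesis .
  qed
  have "incseq C"
  proof (rule incseq_SucI)
    show "C T \<subseteq> C (Suc T)" for T unfolding C_def using le_SucI by blast
  qed
  then have "(\<lambda>T. prob (C T)) \<longlonglongrightarrow> prob (\<Union>T. C T)"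
    using C by (intro finite_Lim_measure_incseq image_subsetI)
  then have "prob (\<Union>T. C T) \<le> majorant s L G x"
    by (rule LIMSEQ_le_const2) (use C_le in auto)
  moreover have "(\<Union>T. C T) = {\<omega>\<in>space M. crosses s (\<lambda>k. X k \<omega>) G}"
    by (auto simp: C_def crosses_def)
  ultimately show ?thesis by simp
qed

section \<open>Measurability of the aggregates\<close>

lemma measurable_send:
  assumes X: "\<And>k. (\<lambda>x. X x k) \<in> measurable M (count_space UNIV)"
    and A: "A \<in> measurable M (count_space (Collect finite))"
  shows "(\<lambda>x. send (X x) (A x)) \<in> measurable M (count_space (Collect finite))"
\<comment> \<open>Finite sets of sites form a countable family, so the aggregate can be frozen at
  each of its values while the walk stays random.\<close>
proof (rule measurable_compose_countable'[where f = "\<lambda>A x. send (X x) A", OF _ A countable_Collect_finite])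
  fix A :: "site set" assume "A \<in> Collect finite"
  then have A: "finite A" by simp
  have [measurable]: "Measurable.pred M (\<lambda>x. X x k \<notin> A)" for k
    using X by (rule measurable_discrete_compose)
  have "(\<lambda>x. LEAST k. X x k \<notin> A) \<in> measurable M (count_space UNIV)"
    by measurable
  from measurable_compose_countable[OF X this]
  have "(\<lambda>x. insert (X x (LEAST k. X x k \<notin> A)) A) \<in> measurable M (count_space (Collect finite))"
    by (rule measurable_compose) (use A in simp)
  moreover have "Measurable.pred M (\<lambda>x. \<exists>k. X x k \<notin> A)" by measurable
  ultimately show "(\<lambda>x. send (X x) A) \<in> measurable M (count_space (Collect finite))"
    unfolding send_def using A by (intro measurable_If) auto
qed

lemma measurable_fold_send:
  assumes "\<And>j k. (\<lambda>x. X x j k) \<in> measurable M (count_space UNIV)"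
    and "A \<in> measurable M (count_space (Collect finite))"
  shows "(\<lambda>x. fold (\<lambda>j. send (X x j)) js (A x)) \<in> measurable M (count_space (Collect finite))"
  using assms(2)
proof (induction js arbitrary: A)
  case (Cons j js)
  show ?case using Cons.IH[OF measurable_send[OF assms(1)[of j] Cons.prems]] by simp
qed simp

lemma measurable_before:
  assumes W: "\<And>i j k. (\<lambda>x. W x i j k) \<in> measurable M (count_space UNIV)"
  shows "(\<lambda>x. before (W x) c m s j) \<in> measurable M (count_space (Collect finite))"
proof -
  have level: "(\<lambda>x. send_level (W x) c i (A x)) \<in> measurable M (count_space (Collect finite))"
    if "A \<in> measurable M (count_space (Collect finite))" for i A
    unfolding send_level_def by (rule measurable_fold_send[OF W that])
  have "(\<lambda>x. aggregate_A (W x) c m) \<in> measurable M (count_space (Collect finite))"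
    by (induction m) (simp_all add: level del: of_nat_Suc)
  then have "(\<lambda>x. if s = 1 then aggregate_A (W x) c m
      else send_level (W x) c (int (Suc m)) (aggregate_A (W x) c m))
    \<in> measurable M (count_space (Collect finite))"
    using level[of "\<lambda>x. aggregate_A (W x) c m" "int (Suc m)"] by (cases "s = 1") simp_all
  with W show ?thesis unfolding before_def by (rule measurable_fold_send)
qed

text \<open>Points outside \<open>K\<close> are included because \<open>measurable_before\<close>
  asks for all indices; there the functions of the product space take the constant value
  \<open>undefined\<close>.\<close>

lemma measurable_path_at:
  "(\<lambda>f. f p k) \<in> measurable (\<Pi>\<^sub>M p\<in>K. path_space) (count_space UNIV)"
proof (cases "p \<in> K")
  case True
  show ?thesis
    by (rule measurable_compose[OF measurable_component_singleton[OF True] measurable_component_singleton]) simp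
next
  case False
  have "(\<lambda>f. f p k) \<in> measurable (\<Pi>\<^sub>M p\<in>K. path_space) (count_space UNIV)
    \<longleftrightarrow> (\<lambda>f. undefined k :: site) \<in> measurable (\<Pi>\<^sub>M p\<in>K. path_space) (count_space UNIV)"
    using False by (intro measurable_cong) (auto simp: space_PiM PiE_def extensional_def)
  then show ?thesis by simp
qed

section \<open>Which particles the aggregates depend on\<close>

lemma send_level_cong:
  assumes "c i = c' i" "\<And>j. j \<ge> 1 \<Longrightarrow> W i j = W' i j"
  shows "send_level W c i A = send_level W' c' i A"
  unfolding send_level_def assms(1) by (rule fold_cong) (auto simp: assms(2))

lemma aggregate_A_cong:
  assumes "\<And>i. \<bar>i\<bar> \<le> int m \<Longrightarrow> c i = c' i"
    and "\<And>i j. \<bar>i\<bar> \<le> int m \<Longrightarrow> j \<ge> 1 \<Longrightarrow> W i j = W' i j"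
  shows "aggregate_A W c m = aggregate_A W' c' m"
  using assms
proof (induction m)
  case 0
  then show ?case using send_level_cong[of c 0 c' W W' "{}"] by simp
next
  case (Suc m)
  have "aggregate_A W c m = aggregate_A W' c' m"
    using Suc.prems by (intro Suc.IH) auto
  moreover have "send_level W c i A = send_level W' c' i A" if "\<bar>i\<bar> = int (Suc m)" for i A
    using Suc.prems that by (intro send_level_cong) auto
  ultimately show ?case by (simp del: of_nat_Suc)
qed

text \<open>Particle \<open>j\<close> of level \<open>s * (m + 1)\<close> is exempt from the
  agreement, because only earlier particles have been sent. This is the source of the independence
  between a walk and the aggregate it meets.\<close>

lemma before_cong:
  assumes "s \<in> {1, -1}"
    and "\<And>i. \<bar>i\<bar> \<le> int (Suc m) \<Longrightarrow> c i = c' i"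
    and "\<And>i j'. \<bar>i\<bar> \<le> int (Suc m) \<Longrightarrow> j' \<ge> 1 \<Longrightarrow> (i, j') \<noteq> (s * int (Suc m), j) \<Longrightarrow> W i j' = W' i j'"
  shows "before W c m s j = before W' c' m s j"
proof -
  have A: "aggregate_A W c m = aggregate_A W' c' m"
  proof (rule aggregate_A_cong)
    fix i j' assume i: "\<bar>i\<bar> \<le> int m" and "j' \<ge> (1::nat)"
    moreover have "i \<noteq> s * int (Suc m)" using i assms(1) by auto
    ultimately show "W i j' = W' i j'" by (intro assms(3)) auto
  qed (use assms(2) in auto)
  \<comment> \<open>For \<open>s = -1\<close> the whole level \<open>m + 1\<close> has been sent
    before, and the exempt particle belongs to another level.\<close>
  have up: "send_level W c (int (Suc m)) A = send_level W' c' (int (Suc m)) A" if "s \<noteq> 1" for A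
  proof (rule send_level_cong)
    have "int (Suc m) \<noteq> s * int (Suc m)" using that assms(1) by auto
    then show "W (int (Suc m)) j' = W' (int (Suc m)) j'" if "j' \<ge> 1" for j'
      using that by (intro assms(3)) auto
  qed (use assms(2) in auto)
  show ?thesis
    unfolding before_def
  proof (rule fold_cong)
    fix j' assume j': "j' \<in> set [1..<j]"
    have "W (s * int (Suc m)) j' = W' (s * int (Suc m)) j'"
    proof (rule assms(3))
      show "\<bar>s * int (Suc m)\<bar> \<le> int (Suc m)" using assms(1) by auto
    qed (use j' in auto)
    then show "send (W (s * int (Suc m)) j') = send (W' (s * int (Suc m)) j')" by simp
  next
    show "(if s = 1 then aggregate_A W c m else send_level W c (int (Suc m)) (aggregate_A W c m))
        = (if s = 1 then aggregate_A W' c' m else send_level W' c' (int (Suc m)) (aggregate_A W' c' m))"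
      unfolding A using up by simp
  qed simp
qed

text \<open>Serves to cut the counts down to the levels of absolute value at most
  \<open>m + 1\<close>, and to disregard the walks numbered 0.\<close>

lemma calm_cong:
  assumes "\<And>i. \<bar>i\<bar> \<le> int (Suc m) \<Longrightarrow> c i = c' i"
    and "\<And>i j. \<bar>i\<bar> \<le> int (Suc m) \<Longrightarrow> j \<ge> 1 \<Longrightarrow> W i j = W' i j"
  shows "calm W c m \<longleftrightarrow> calm W' c' m"
  unfolding calm_def
proof (intro ball_cong refl)
  fix s :: int assume s: "s \<in> {1, -1}"
  show "{1..c (s * int (Suc m))} = {1..c' (s * int (Suc m))}"
    using s by (subst assms(1)) auto
  fix j assume j: "j \<in> {1..c' (s * int (Suc m))}"
  have "W (s * int (Suc m)) j = W' (s * int (Suc m)) j"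
  proof (rule assms(2))
    show "\<bar>s * int (Suc m)\<bar> \<le> int (Suc m)" using s by auto
  qed (use j in simp)
  moreover have "before W c m s j = before W' c' m s j"
    by (rule before_cong[OF s assms])
  ultimately show "\<not> crosses s (W (s * int (Suc m)) j) (before W c m s j)
      \<longleftrightarrow> \<not> crosses s (W' (s * int (Suc m)) j) (before W' c' m s j)" by simp
qed

section \<open>Size of the aggregates\<close>

lemma sum_symmetric_Suc:
  fixes f :: "int \<Rightarrow> nat"
  shows "(\<Sum>i\<in>{- int (Suc m)..int (Suc m)}. f i)
       = f (int (Suc m)) + f (- int (Suc m)) + (\<Sum>i\<in>{- int m..int m}. f i)"
proof -
  have "{- int (Suc m)..int (Suc m)} = insert (int (Suc m)) (insert (- int (Suc m)) {- int m..int m})"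
    by auto
  moreover have "int (Suc m) \<notin> insert (- int (Suc m)) {- int m..int m}" "- int (Suc m) \<notin> {- int m..int m}"
    by auto
  ultimately show ?thesis by (simp del: of_nat_Suc)
qed

lemma card_send_level_le: "card (send_level W c i A) \<le> c i + card A"
  unfolding send_level_def using card_fold_send_le[of "W i" "[1..<Suc (c i)]" A] by (simp del: upt_Suc)

lemma card_aggregate_A_le: "card (aggregate_A W c m) \<le> (\<Sum>i\<in>{- int m..int m}. c i)"
proof (induction m)
  case 0
  then show ?case using card_send_level_le[of W c 0 "{}"] by simp
next
  case (Suc m)
  then show ?case
    unfolding sum_symmetric_Suc aggregate_A.simps
    using card_send_level_le[of W c "int (Suc m)" "aggregate_A W c m"]
      card_send_level_le[of W c "- int (Suc m)" "send_level W c (int (Suc m)) (aggregate_A W c m)"]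
    by linarith
qed

lemma card_before_le:
  assumes "s \<in> {1, -1}" "j \<le> c (s * int (Suc m))"
  shows "card (before W c m s j) \<le> (\<Sum>i\<in>{- int (Suc m)..int (Suc m)}. c i)"
proof -
  let ?A = "if s = 1 then aggregate_A W c m else send_level W c (int (Suc m)) (aggregate_A W c m)"
  have "card (before W c m s j) \<le> (j - 1) + card ?A"
    unfolding before_def using card_fold_send_le[of "W (s * int (Suc m))" "[1..<j]" ?A] by simp
  then show ?thesis
    unfolding sum_symmetric_Suc using assms card_aggregate_A_le[of W c m]
      card_send_level_le[of W c "int (Suc m)" "aggregate_A W c m"]
    by (auto simp del: of_nat_Suc)
qed

text \<open>Law of total probability: the disjoint events \<open>A i\<close> record the value of a
  discrete variable, and \<open>b\<close> bounds the conditional probability of \<open>B i\<close>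
  given each of them. The variable will be first an aggregate, then the family of counts.\<close>

lemma (in prob_space) prob_UN_le:
  assumes I: "countable I" and disj: "disjoint_family_on A I"
    and A: "\<And>i. i \<in> I \<Longrightarrow> A i \<in> events" and B: "\<And>i. i \<in> I \<Longrightarrow> B i \<in> events"
    and le: "\<And>i. i \<in> I \<Longrightarrow> prob (A i \<inter> B i) \<le> b * prob (A i)" and b: "0 \<le> b"
  shows "prob (\<Union>i\<in>I. A i \<inter> B i) \<le> b"
proof -
  have "disjoint_family_on (\<lambda>i. A i \<inter> B i) I"
    using disj by (auto simp: disjoint_family_on_def)
  then have "emeasure M (\<Union>i\<in>I. A i \<inter> B i) = (\<integral>\<^sup>+i. emeasure M (A i \<inter> B i) \<partial>count_space I)"
    using A B I by (intro emeasure_UN_countable) auto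
  also have "\<dots> \<le> (\<integral>\<^sup>+i. ennreal b * emeasure M (A i) \<partial>count_space I)"
    using le b by (intro nn_integral_mono) (simp add: emeasure_eq_measure flip: ennreal_mult)
  also have "\<dots> = ennreal b * emeasure M (\<Union>i\<in>I. A i)"
    using A I disj by (subst emeasure_UN_countable) (auto simp: nn_integral_cmult)
  also have "\<dots> \<le> ennreal b * 1"
    by (intro mult_left_mono) (auto simp: emeasure_eq_measure)
  finally show ?thesis using b by (simp add: emeasure_eq_measure)
qed

text \<open>The square root reflects that only half of the rows are guaranteed to be thin;
  \<open>2 * C\<close> is the threshold of \<open>thin_rows_ge\<close>.\<close>

definition rate :: "nat \<Rightarrow> real" where
  "rate C = sqrt (1 - (1/4) ^ (2 * C))"

lemma rate_bounds: "0 \<le> rate C" "rate C < 1"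
  using base_bounds[of "2 * C"] by (auto simp: rate_def)

lemma majorant_le_rate:
  assumes "finite G" "s \<in> {1, -1}" "card G \<le> C * k"
  shows "majorant s (2 * C) G (0, s * int k) \<le> rate C ^ k"
proof -
  have "majorant s (2 * C) G (0, s * int k)
      \<le> (1 - (1/4) ^ (2 * C)) ^ thin_rows s (2 * C) G (int k)"
    using majorant_le[OF assms(1,2), of "2 * C" "(0, s * int k)"] assms(2) by auto
  also have "\<dots> = rate C ^ (2 * thin_rows s (2 * C) G (int k))"
    using base_bounds[of "2 * C"] by (simp add: rate_def power_mult)
  also have "\<dots> \<le> rate C ^ k"
    using rate_bounds[of C] thin_rows_ge[OF assms] by (intro power_decreasing) auto
  finally show ?thesis .
qed

text \<open>The aggregate met by the particle is a function of the other walks, hence independent of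
  its own. Conditioning on its value \<open>G\<close> leaves a walk facing a fixed set of at most
  \<open>C * (m + 1)\<close> sites.\<close>

lemma (in prob_space) prob_particle_crosses_le:
  assumes walks: "independent_walks M S" and s: "s \<in> {1, -1}"
    and j: "j \<in> {1..c (s * int (Suc m))}"
    and size: "(\<Sum>i\<in>{- int (Suc m)..int (Suc m)}. c i) \<le> C * Suc m"
  defines "D \<equiv> {\<omega>\<in>space M. crosses s (\<lambda>k. S (s * int (Suc m)) j k \<omega>)
      (before (\<lambda>i j k. S i j k \<omega>) c m s j)}"
  shows "D \<in> events" "prob D \<le> rate C ^ Suc m"
proof -
  define p where "p = (s * int (Suc m), j)"
  define Q where "Q = particles - {p}"
  define X where "X = (\<lambda>(i, j) \<omega> k. S i j k \<omega>)"
  define W where "W f = (\<lambda>i j. f (i, j))" for f :: "int \<times> nat \<Rightarrow> nat \<Rightarrow> site"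
  let ?K = "\<lambda>K. \<Pi>\<^sub>M p\<in>K. path_space"
  have p: "p \<in> particles" using j by (simp add: p_def particles_def)
  have walk: "simple_random_walk M (0, s * int (Suc m)) (S (s * int (Suc m)) j)"
    using walks p by (auto simp: independent_walks_def p_def)
  have indep: "indep_var (?K {p}) (\<lambda>\<omega>. restrict (\<lambda>q. X q \<omega>) {p}) (?K Q) (\<lambda>\<omega>. restrict (\<lambda>q. X q \<omega>) Q)"
    using walks p by (intro indep_var_restrict[of "\<lambda>_. path_space" X particles])
      (auto simp: independent_walks_def X_def Q_def)
  note rv = indep_var_rv1[OF indep] indep_var_rv2[OF indep]
  define E where "E G = {f\<in>space (?K {p}). crosses s (f p) G}" for G
  define F where "F G = {f\<in>space (?K Q). before (W f) c m s j = G}" for G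
  have E: "E G \<in> sets (?K {p})" for G
  proof -
    have "Measurable.pred (?K {p}) (\<lambda>f. crosses s (f p) G)"
      by (intro pred_crosses measurable_path_at)
    then show ?thesis by (simp add: E_def pred_def)
  qed
  have mF: "(\<lambda>f. before (W f) c m s j) \<in> measurable (?K Q) (count_space (Collect finite))"
    unfolding W_def by (intro measurable_before measurable_path_at)
  have F: "F G \<in> sets (?K Q)" if "finite G" for G
    using measurable_sets[OF mF, of "{G}"] that by (simp add: F_def vimage_def Int_def conj_commute)
  define A where "A G = (\<lambda>\<omega>. restrict (\<lambda>q. X q \<omega>) Q) -` F G \<inter> space M" for G
  define B where "B G = (\<lambda>\<omega>. restrict (\<lambda>q. X q \<omega>) {p}) -` E G \<inter> space M" for G
  \<comment> \<open>Restriction to \<open>Q\<close> replaces the walk of \<open>p\<close> and the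
    walks outside \<open>particles\<close> by \<open>undefined\<close>, which
    \<open>before_cong\<close> tolerates.\<close>
  have before_eq: "before (W (restrict (\<lambda>q. X q \<omega>) Q)) c m s j = before (\<lambda>i j k. S i j k \<omega>) c m s j" for \<omega>
    using s by (intro before_cong) (auto simp: W_def X_def Q_def p_def particles_def)
  have A_eq: "A G = {\<omega>\<in>space M. before (\<lambda>i j k. S i j k \<omega>) c m s j = G}" for G
    using measurable_space[OF rv(2)] by (auto simp: A_def F_def before_eq)
  have B_eq: "B G = {\<omega>\<in>space M. crosses s (\<lambda>k. S (s * int (Suc m)) j k \<omega>) G}" for G
    using measurable_space[OF rv(1)] by (auto simp: B_def E_def X_def p_def)
  have A_sets: "A G \<in> events" if "finite G" for G
    unfolding A_def by (rule measurable_sets[OF rv(2) F[OF that]])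
  have B_sets: "B G \<in> events" for G
    unfolding B_def by (rule measurable_sets[OF rv(1) E])
  have fin: "finite (before W c m s j)" for W
    by (auto simp: before_def send_level_def finite_fold_send finite_aggregate_A)
  have D_eq: "D = (\<Union>G\<in>Collect finite. A G \<inter> B G)"
    using fin by (auto simp: D_def A_eq B_eq)
  show "D \<in> events"
    unfolding D_eq using A_sets B_sets by (intro sets.countable_UN' countable_Collect_finite) auto
  show "prob D \<le> rate C ^ Suc m"
    unfolding D_eq
  proof (rule prob_UN_le[OF countable_Collect_finite])
    show "disjoint_family_on A (Collect finite)" by (auto simp: disjoint_family_on_def A_eq)
    fix G :: "site set" assume "G \<in> Collect finite"
    then have G: "finite G" by simp
    show "prob (A G \<inter> B G) \<le> rate C ^ Suc m * prob (A G)"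
    \<comment> \<open>The size bound is available for those \<open>G\<close> that are actually
      attained.\<close>
    proof (cases "A G = {}")
      case False
      then obtain \<omega> where "before (\<lambda>i j k. S i j k \<omega>) c m s j = G" by (auto simp: A_eq)
      then have "card G \<le> C * Suc m"
        using card_before_le[OF s, of j c m "\<lambda>i j k. S i j k \<omega>"] j size by simp
      then have "prob (B G) \<le> rate C ^ Suc m"
        unfolding B_eq
        using prob_crosses_le[OF walk G s, of "2 * C"] majorant_le_rate[OF G s] by fastforce
      moreover have eq: "(\<lambda>\<omega>. (restrict (\<lambda>q. X q \<omega>) {p}, restrict (\<lambda>q. X q \<omega>) Q)) -` (E G \<times> F G) \<inter> space M
          = A G \<inter> B G"
        by (auto simp: A_def B_def)
      have "prob (A G \<inter> B G) = prob (B G) * prob (A G)"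
        unfolding eq[symmetric] unfolding A_def B_def by (rule indep_varD[OF indep E F[OF G]])
      ultimately show ?thesis by (simp add: mult_right_mono)
    qed simp
  qed (use A_sets B_sets rate_bounds in auto)
qed

text \<open>Union bound over the particles of levels \<open>m + 1\<close> and
  \<open>- (m + 1)\<close>, which are among those counted in \<open>size\<close>.\<close>

lemma (in prob_space) prob_not_calm_le:
  assumes walks: "independent_walks M S"
    and size: "(\<Sum>i\<in>{- int (Suc m)..int (Suc m)}. c i) \<le> C * Suc m"
  shows "{\<omega>\<in>space M. \<not> calm (\<lambda>i j k. S i j k \<omega>) c m} \<in> events"
    and "prob {\<omega>\<in>space M. \<not> calm (\<lambda>i j k. S i j k \<omega>) c m} \<le> real (C * Suc m) * rate C ^ Suc m"
proof -
  define D where "D s j = {\<omega>\<in>space M. crosses s (\<lambda>k. S (s * int (Suc m)) j k \<omega>)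
      (before (\<lambda>i j k. S i j k \<omega>) c m s j)}" for s j
  define J where "J = (SIGMA s:{1, -1::int}. {1..c (s * int (Suc m))})"
  have J: "finite J" "card J \<le> C * Suc m"
    using size unfolding sum_symmetric_Suc by (auto simp: J_def simp del: of_nat_Suc mult_Suc_right)
  have D: "D s j \<in> events" "prob (D s j) \<le> rate C ^ Suc m" if "(s, j) \<in> J" for s j
  proof -
    have sj: "s \<in> {1, -1}" "j \<in> {1..c (s * int (Suc m))}"
      using that unfolding J_def by blast+
    show "D s j \<in> events" "prob (D s j) \<le> rate C ^ Suc m"
      unfolding D_def by (rule prob_particle_crosses_le[OF walks sj size])+
  qed
  have eq: "{\<omega>\<in>space M. \<not> calm (\<lambda>i j k. S i j k \<omega>) c m} = (\<Union>(s, j)\<in>J. D s j)"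
  proof -
    have "{\<omega>\<in>space M. \<not> (\<forall>s\<in>T. \<forall>j\<in>U s. \<not> R s j \<omega>)}
        = (\<Union>(s, j)\<in>Sigma T U. {\<omega>\<in>space M. R s j \<omega>})"
      for T :: "int set" and U :: "int \<Rightarrow> nat set" and R by auto
    then show ?thesis unfolding calm_def D_def J_def .
  qed
  show "{\<omega>\<in>space M. \<not> calm (\<lambda>i j k. S i j k \<omega>) c m} \<in> events"
    unfolding eq using J D by (intro sets.finite_UN) auto
  have "prob (\<Union>(s, j)\<in>J. D s j) \<le> (\<Sum>(s, j)\<in>J. prob (D s j))"
    using J D finite_measure_subadditive_finite[of J "\<lambda>(s, j). D s j"]
    by (force simp: case_prod_unfold image_subset_iff)
  also have "\<dots> \<le> (\<Sum>(s, j)\<in>J. rate C ^ Suc m)"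
    using D by (intro sum_mono) auto
  also have "\<dots> = real (card J) * rate C ^ Suc m" by (simp add: case_prod_unfold)
  also have "\<dots> \<le> real (C * Suc m) * rate C ^ Suc m"
    using J(2) rate_bounds by (intro mult_right_mono of_nat_mono) auto
  finally show "prob {\<omega>\<in>space M. \<not> calm (\<lambda>i j k. S i j k \<omega>) c m}
      \<le> real (C * Suc m) * rate C ^ Suc m"
    unfolding eq .
qed

text \<open>Borel--Cantelli for the events that the counts obey the bound although stage
  \<open>m\<close> is not calm. Independence from the walks lets the counts be frozen, which covers
  fixed and Poisson counts alike.\<close>

lemma (in prob_space) AE_eventually_calm:
  assumes walks: "independent_walks M S"
    and indep: "indep_set
       (sets (vimage_algebra (space M) (\<lambda>\<omega> i. N i \<omega>) (\<Pi>\<^sub>M i\<in>UNIV. count_space UNIV)))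
       (sets (vimage_algebra (space M) (\<lambda>\<omega>. \<lambda>(i, j)\<in>particles. \<lambda>k. S i j k \<omega>)
         (\<Pi>\<^sub>M p\<in>particles. path_space)))"
    and size: "AE \<omega> in M. \<forall>\<^sub>F m in sequentially.
       (\<Sum>i\<in>{- int (Suc m)..int (Suc m)}. N i \<omega>) \<le> C * Suc m"
  shows "AE \<omega> in M. \<forall>\<^sub>F m in sequentially. calm (\<lambda>i j k. S i j k \<omega>) (\<lambda>i. N i \<omega>) m"
proof -
  let ?KN = "\<Pi>\<^sub>M i\<in>(UNIV::int set). count_space (UNIV::nat set)"
  let ?Y = "\<lambda>\<omega>. \<lambda>(i, j)\<in>particles. \<lambda>k. S i j k \<omega>"
  define L where "L m = {- int (Suc m)..int (Suc m)}" for m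
  \<comment> \<open>The bound on the total also bounds each single count, so only finitely many
    functions on the window \<open>L m\<close> can occur.\<close>
  define I where "I m = {c \<in> L m \<rightarrow>\<^sub>E {..C * Suc m}. sum c (L m) \<le> C * Suc m}" for m
  define A where "A m c = {\<omega>\<in>space M. \<forall>i\<in>L m. N i \<omega> = c i}" for m c
  define B where "B m c = {\<omega>\<in>space M. \<not> calm (\<lambda>i j k. S i j k \<omega>) c m}" for m c
  have finI: "finite (I m)" for m
  proof (rule finite_subset)
    show "I m \<subseteq> L m \<rightarrow>\<^sub>E {..C * Suc m}" unfolding I_def by blast
    show "finite (L m \<rightarrow>\<^sub>E {..C * Suc m})" by (rule finite_PiE) (simp_all add: L_def)
  qed
  have A_alg: "A m c \<in> sets (vimage_algebra (space M) (\<lambda>\<omega> i. N i \<omega>) ?KN)" for m c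
  proof -
    have "Measurable.pred ?KN (\<lambda>f. f i = c i)" for i
      by (rule measurable_discrete_compose[where f = "\<lambda>x. x = c i" and X = "\<lambda>f. f i",
          OF measurable_component_singleton]) simp
    then have "{f\<in>space ?KN. \<forall>i\<in>L m. f i = c i} \<in> sets ?KN"
      by (intro sets.sets_Collect_finite_All) (auto simp: L_def pred_def)
    from in_vimage_algebra[OF this] show ?thesis
      by (rule back_subst[of "\<lambda>A. A \<in> _"]) (auto simp: A_def space_PiM)
  qed
  have B_alg: "B m c \<in> sets (vimage_algebra (space M) ?Y (\<Pi>\<^sub>M p\<in>particles. path_space))" for m c
  proof -
    let ?K = "\<Pi>\<^sub>M p\<in>particles. path_space"
    have cr: "Measurable.pred ?K (\<lambda>f. crosses s (f (i, j)) (before (\<lambda>i j. f (i, j)) c m s j))" for s i j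
      by (rule measurable_compose_countable'[where f = "\<lambda>A f. crosses s (f (i, j)) A",
          OF _ _ countable_Collect_finite])
        (intro pred_crosses measurable_before measurable_path_at)+
    have "Measurable.pred ?K (\<lambda>f. \<not> calm (\<lambda>i j. f (i, j)) c m)"
      unfolding calm_def
      by (intro pred_intros_logic pred_intros_finite cr) auto
    then have "{f\<in>space ?K. \<not> calm (\<lambda>i j. f (i, j)) c m} \<in> sets ?K" by (simp add: pred_def)
    from in_vimage_algebra[OF this] show ?thesis
    proof (rule back_subst[of "\<lambda>A. A \<in> _"])
      \<comment> \<open>Off \<open>particles\<close> the restricted family is
        \<open>undefined\<close>, but \<open>calm\<close> reads only walks numbered from 1.\<close>
      have "calm (\<lambda>i j. ?Y \<omega> (i, j)) c m \<longleftrightarrow> calm (\<lambda>i j k. S i j k \<omega>) c m" for \<omega>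
        by (intro calm_cong) (auto simp: particles_def)
      then show "?Y -` {f\<in>space ?K. \<not> calm (\<lambda>i j. f (i, j)) c m} \<inter> space M = B m c"
        by (auto simp: B_def space_PiM)
    qed
  qed
  have A_sets: "A m c \<in> events" and B_sets: "B m c \<in> events" for m c
    by (rule subsetD[OF indep_setD_ev1[OF indep] A_alg], rule subsetD[OF indep_setD_ev2[OF indep] B_alg])
  define E where "E m = (\<Union>c\<in>I m. A m c \<inter> B m c)" for m
  have E_sets: "E m \<in> events" for m
    unfolding E_def by (intro sets.finite_UN finI sets.Int A_sets B_sets)
  have E_le: "prob (E m) \<le> real (C * Suc m) * rate C ^ Suc m" for m
    unfolding E_def
  proof (rule prob_UN_le[OF countable_finite[OF finI]])
    show "disjoint_family_on (A m) (I m)"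
      unfolding disjoint_family_on_def
    proof (intro ballI impI)
      fix c c' assume c: "c \<in> I m" "c' \<in> I m" "c \<noteq> c'"
      then obtain i where "i \<in> L m" "c i \<noteq> c' i"
        using PiE_ext[of c "L m" "\<lambda>_. {..C * Suc m}" c'] unfolding I_def by blast
      then show "A m c \<inter> A m c' = {}" by (auto simp: A_def)
    qed
    fix c assume c: "c \<in> I m"
    have "prob (A m c \<inter> B m c) = prob (A m c) * prob (B m c)"
      by (rule indep_setD[OF indep A_alg B_alg])
    moreover have "prob (B m c) \<le> real (C * Suc m) * rate C ^ Suc m"
      using prob_not_calm_le(2)[OF walks, of c m C] c by (simp add: I_def L_def B_def del: of_nat_Suc mult_Suc_right)
    ultimately show "prob (A m c \<inter> B m c) \<le> real (C * Suc m) * rate C ^ Suc m * prob (A m c)"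
      by (simp add: mult.commute mult_left_mono del: of_nat_Suc mult_Suc_right power_Suc)
  qed (auto intro: A_sets B_sets simp: rate_bounds)
  \<comment> \<open>The linear factor is handled by the differentiated geometric series.\<close>
  have "summable (\<lambda>m. real (C * Suc m) * rate C ^ Suc m)"
  proof -
    have "summable (\<lambda>m. of_nat (Suc m) * rate C ^ m)"
      using geometric_deriv_sums[of "rate C"] rate_bounds[of C] by (auto simp: sums_iff)
    from summable_mult[OF this, of "real C * rate C"] show ?thesis
      by (rule summable_cong[THEN iffD1, rotated]) (simp add: algebra_simps)
  qed
  then have "summable (\<lambda>m. prob (E m))"
    by (rule summable_comparison_test') (use E_le in simp)
  then have "AE \<omega> in M. \<forall>\<^sub>F m in sequentially. \<omega> \<in> space M - E m"
    using E_sets by (intro borel_cantelli_AE1) (auto simp: emeasure_eq_measure)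
  with size show ?thesis
  proof eventually_elim
    case (elim \<omega>)
    show ?case
      using elim
    proof eventually_elim
      case (elim m)
      \<comment> \<open>Truncating the actual counts to the window gives an element of
        \<open>I m\<close> and leaves \<open>calm\<close> unchanged.\<close>
      define c where "c = restrict (\<lambda>i. N i \<omega>) (L m)"
      have L: "finite (L m)" by (simp add: L_def)
      have sum_c: "sum c (L m) \<le> C * Suc m"
        using elim(1) unfolding L_def[symmetric] by (simp add: c_def del: mult_Suc_right)
      have "c i \<le> sum c (L m)" if "i \<in> L m" for i
        using member_le_sum[of i "L m" c] L that by simp
      then have "c \<in> I m"
        using sum_c by (auto simp: I_def c_def intro: order_trans simp del: mult_Suc_right)
      moreover have "\<omega> \<in> A m c" using elim(2) by (auto simp: A_def c_def)
      ultimately have "calm (\<lambda>i j k. S i j k \<omega>) c m"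
        using elim(2) unfolding E_def B_def by blast
      moreover have "calm (\<lambda>i j k. S i j k \<omega>) c m \<longleftrightarrow> calm (\<lambda>i j k. S i j k \<omega>) (\<lambda>i. N i \<omega>) m"
        by (rule calm_cong) (auto simp: c_def L_def)
      ultimately show ?case by simp
    qed
  qed
qed

subsection \<open>Number of particles\<close>

text \<open>Generating function of the Poisson law at 2, that is \<open>exp (r * (2 - 1))\<close>;
  it feeds the exponential Markov bound for the total count.\<close>

lemma nn_integral_two_power_poisson:
  assumes "r > 0"
  shows "(\<integral>\<^sup>+k. ennreal (2 ^ k) \<partial>measure_pmf (poisson_pmf r)) = ennreal (exp r)"
proof -
  have "(\<lambda>k. (2 * r) ^ k /\<^sub>R fact k * exp (- r)) sums (exp (2 * r) * exp (- r))"
    by (intro sums_mult2 exp_converges)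
  then have sums: "(\<lambda>k. r ^ k / fact k * exp (- r) * 2 ^ k) sums exp r"
    by (simp add: power_mult_distrib scaleR_conv_of_real divide_inverse mult_ac flip: exp_add)
  have "(\<integral>\<^sup>+k. ennreal (2 ^ k) \<partial>measure_pmf (poisson_pmf r))
      = (\<Sum>k. ennreal (r ^ k / fact k * exp (- r) * 2 ^ k))"
    using assms
    by (simp add: nn_integral_measure_pmf nn_integral_count_space_nat flip: ennreal_mult)
  also have "\<dots> = ennreal (exp r)"
    using assms by (intro suminf_ennreal_eq sums) auto
  finally show ?thesis .
qed

text \<open>Chernoff bound: Markov's inequality for 2 to the power of the total count, whose mean
  factorises by independence, followed by Borel--Cantelli.\<close>

lemma (in prob_space) poisson_counts_sum_le:
  assumes N: "poisson_counts M r S N" and r: "r > 0"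
  shows "\<exists>C. AE \<omega> in M. \<forall>\<^sub>F m in sequentially.
    (\<Sum>i\<in>{- int (Suc m)..int (Suc m)}. N i \<omega>) \<le> C * Suc m"
proof -
  have indep: "indep_vars (\<lambda>_. count_space UNIV) N UNIV"
    and distr: "distr M (count_space UNIV) (N i) = measure_pmf (poisson_pmf r)" for i
    using N by (auto simp: poisson_counts_def)
  have N_meas [measurable]: "N i \<in> measurable M (count_space UNIV)" for i
    using indep by (simp add: indep_vars_def)
  \<comment> \<open>Chosen so that \<open>exp (3 * r) / 2 ^ C < 1/2\<close>; the 3 stems from
    \<open>2 * m + 3 \<le> 3 * (m + 1)\<close>, the left side being the number of levels in the
    window.\<close>
  obtain C where C: "2 * exp (3 * r) < 2 ^ C"
    using real_arch_pow[of 2 "2 * exp (3 * r)"] by auto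
  define I where "I m = {- int (Suc m)..int (Suc m)}" for m
  define A where "A m = {\<omega>\<in>space M. real (C * Suc m) < (\<Sum>i\<in>I m. real (N i \<omega>))}" for m
  have A_sets: "A m \<in> events" for m unfolding A_def by measurable
  have A_le: "prob (A m) \<le> (1/2) ^ Suc m" for m
  proof -
    define u where "u \<omega> = (\<Prod>i\<in>I m. ennreal (2 ^ N i \<omega>))" for \<omega>
    let ?c = "ennreal ((1/2) ^ (C * Suc m))"
    have u: "u \<in> borel_measurable M" unfolding u_def by measurable
    have "(\<integral>\<^sup>+\<omega>. ennreal (2 ^ N i \<omega>) \<partial>M) = ennreal (exp r)" for i
    proof -
      have "(\<integral>\<^sup>+\<omega>. ennreal (2 ^ N i \<omega>) \<partial>M)
          = (\<integral>\<^sup>+k. ennreal (2 ^ k) \<partial>distr M (count_space UNIV) (N i))"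
        by (subst nn_integral_distr) auto
      then show ?thesis by (simp only: distr nn_integral_two_power_poisson[OF r])
    qed
    moreover have "(\<integral>\<^sup>+\<omega>. u \<omega> \<partial>M) = (\<Prod>i\<in>I m. \<integral>\<^sup>+\<omega>. ennreal (2 ^ N i \<omega>) \<partial>M)"
      unfolding u_def
    proof (rule indep_vars_nn_integral)
      show "indep_vars (\<lambda>_. borel) (\<lambda>i \<omega>. ennreal (2 ^ N i \<omega>)) (I m)"
        by (rule indep_vars_compose2[OF indep_vars_subset[OF indep]]) auto
    qed (auto simp: I_def)
    ultimately have int_u: "(\<integral>\<^sup>+\<omega>. u \<omega> \<partial>M) = ennreal (exp r ^ card (I m))"
      by (simp add: ennreal_power)
    have "A m \<subseteq> {\<omega>\<in>space M. 1 \<le> ?c * u \<omega>}"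
    proof
      fix \<omega> assume \<omega>: "\<omega> \<in> A m"
      have u_eq: "u \<omega> = ennreal (2 ^ (\<Sum>i\<in>I m. N i \<omega>))"
        by (simp add: u_def prod_ennreal power_sum)
      have "real (C * Suc m) < real (\<Sum>i\<in>I m. N i \<omega>)"
        using \<omega> unfolding A_def of_nat_sum by blast
      then have "C * Suc m \<le> (\<Sum>i\<in>I m. N i \<omega>)" by linarith
      then have "(2::real) ^ (C * Suc m) \<le> 2 ^ (\<Sum>i\<in>I m. N i \<omega>)"
        by (intro power_increasing) auto
      then have "1 \<le> (1/2) ^ (C * Suc m) * (2::real) ^ (\<Sum>i\<in>I m. N i \<omega>)"
        by (simp add: power_divide del: mult_Suc_right)
      then have "1 \<le> ?c * u \<omega>"
        unfolding u_eq by (simp flip: ennreal_mult del: mult_Suc_right)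
      then show "\<omega> \<in> {\<omega>\<in>space M. 1 \<le> ?c * u \<omega>}" using \<omega> by (simp add: A_def)
    qed
    then have "emeasure M (A m) \<le> emeasure M {\<omega>\<in>space M. 1 \<le> ?c * u \<omega>}"
      using u by (intro emeasure_mono) measurable
    also have "\<dots> \<le> ?c * (\<integral>\<^sup>+\<omega>. u \<omega> * indicator (space M) \<omega> \<partial>M)"
      using u by (intro nn_integral_Markov_inequality) auto
    also have "(\<integral>\<^sup>+\<omega>. u \<omega> * indicator (space M) \<omega> \<partial>M) = ennreal (exp r ^ card (I m))"
      unfolding int_u[symmetric] by (intro nn_integral_cong) simp
    also have "?c * ennreal (exp r ^ card (I m)) = ennreal ((1/2) ^ (C * Suc m) * exp r ^ card (I m))"
      by (simp add: ennreal_mult)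
    finally have "prob (A m) \<le> (1/2) ^ (C * Suc m) * exp r ^ card (I m)"
      by (simp add: emeasure_eq_measure del: mult_Suc_right)
    also have "\<dots> \<le> (1/2) ^ (C * Suc m) * exp r ^ (3 * Suc m)"
      using r by (intro mult_left_mono power_increasing) (auto simp: I_def)
    also have "\<dots> = (exp (3 * r) / 2 ^ C) ^ Suc m"
      by (simp only: power_mult exp_of_nat_mult[symmetric] power_divide power_one of_nat_numeral) simp
    also have "\<dots> \<le> (1/2) ^ Suc m"
      using C by (intro power_mono) (auto simp: field_simps)
    finally show ?thesis .
  qed
  have "summable (\<lambda>m. (1/2::real) ^ Suc m)"
    unfolding summable_Suc_iff by (rule summable_geometric) simp
  then have "summable (\<lambda>m. prob (A m))"
    by (rule summable_comparison_test') (use A_le in simp)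
  then have "AE \<omega> in M. \<forall>\<^sub>F m in sequentially. \<omega> \<in> space M - A m"
    using A_sets by (intro borel_cantelli_AE1) (auto simp: emeasure_eq_measure)
  then have "AE \<omega> in M. \<forall>\<^sub>F m in sequentially.
    (\<Sum>i\<in>{- int (Suc m)..int (Suc m)}. N i \<omega>) \<le> C * Suc m"
  proof eventually_elim
    case (elim \<omega>)
    then show ?case
    proof eventually_elim
      case (elim m)
      then have "real (\<Sum>i\<in>I m. N i \<omega>) \<le> real (C * Suc m)"
        unfolding A_def by (auto simp del: mult_Suc_right of_nat_mult)
      then show ?case unfolding I_def of_nat_le_iff .
    qed
  qed
  then show ?thesis by blast
qed

section \<open>Deterministic counts and conclusion\<close>

lemma (in prob_space) indep_set_constant:
  assumes "G \<subseteq> events"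
  shows "indep_set (sets (vimage_algebra (space M) (\<lambda>_. a) K)) G"
proof (rule indep_setI)
  \<comment> \<open>A constant map generates the trivial sigma-algebra, which is independent of any
    family of events. This makes the fixed count \<open>n\<close> an instance of random
    counts.\<close>
  have sub: "sets (vimage_algebra (space M) (\<lambda>_. a) K) \<subseteq> {{}, space M}"
    unfolding sets_vimage_algebra
  proof
    fix A assume "A \<in> sigma_sets (space M) {(\<lambda>_. a) -` A \<inter> space M |A. A \<in> sets K}"
    then show "A \<in> {{}, space M}"
    proof induction
      case (Basic A)
      then obtain B where "A = (\<lambda>_. a) -` B \<inter> space M" by blast
      then show ?case by (cases "a \<in> B") auto
    next
      case (Union F)
      then have F: "F i = {} \<or> F i = space M" for i by blast
      then have sub: "(\<Union>i. F i) \<subseteq> space M" by blast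
      show ?case
      proof (cases "\<exists>i. F i = space M")
        case True
        then have "space M \<subseteq> (\<Union>i. F i)" by blast
        with sub show ?thesis by blast
      next
        case False
        then show ?thesis using F by simp
      qed
    qed auto
  qed
  then show "sets (vimage_algebra (space M) (\<lambda>_. a) K) \<subseteq> events" by auto
  fix A B assume "A \<in> sets (vimage_algebra (space M) (\<lambda>_. a) K)" "B \<in> G"
  then have "A = {} \<or> A = space M" "B \<in> events" using sub assms by auto
  then show "prob (A \<inter> B) = prob A * prob B"
    using sets.sets_into_space[of B M] by (auto simp: prob_space Int_absorb1)
qed (use assms in auto)

lemma (in prob_space) walks_vimage_subset_events:
  assumes "independent_walks M S"
  shows "sets (vimage_algebra (space M) (\<lambda>\<omega>. \<lambda>(i, j)\<in>particles. \<lambda>k. S i j k \<omega>)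
         (\<Pi>\<^sub>M p\<in>particles. path_space)) \<subseteq> events"
proof (rule sets_image_in_sets)
  have "(\<lambda>\<omega>. \<lambda>p\<in>particles. (case p of (i, j) \<Rightarrow> \<lambda>\<omega> k. S i j k \<omega>) \<omega>)
      \<in> measurable M (\<Pi>\<^sub>M p\<in>particles. path_space)"
    using assms by (intro measurable_restrict) (simp add: independent_walks_def indep_vars_def)
  moreover have "(\<lambda>\<omega>. \<lambda>p\<in>particles. (case p of (i, j) \<Rightarrow> \<lambda>\<omega> k. S i j k \<omega>) \<omega>)
      = (\<lambda>\<omega>. \<lambda>(i, j)\<in>particles. \<lambda>k. S i j k \<omega>)"
    by (intro ext) (auto simp: restrict_def split: prod.splits)
  ultimately show "(\<lambda>\<omega>. \<lambda>(i, j)\<in>particles. \<lambda>k. S i j k \<omega>)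
      \<in> measurable M (\<Pi>\<^sub>M p\<in>particles. path_space)" by simp
qed simp

theorem theorem4p1:
  fixes P :: "'w measure"
    and S :: "int \<Rightarrow> nat \<Rightarrow> nat \<Rightarrow> 'w \<Rightarrow> site"
    and n :: nat
  assumes "prob_space P"
    and "independent_walks P S"
    and "n \<ge> 1"
  shows "(AE \<omega> in P. \<exists>M\<^sub>0. \<forall>M\<ge>M\<^sub>0. \<exists>t\<^sub>0\<ge>M. \<forall>t\<ge>t\<^sub>0.
            aggregate_A_inf (\<lambda>i j k. S i j k \<omega>) (\<lambda>i. n) \<inter> half_plane t
              = aggregate_B_inf (\<lambda>i j k. S i j k \<omega>) (\<lambda>i. n) M \<inter> half_plane t)
       \<and> (\<forall>N :: int \<Rightarrow> 'w \<Rightarrow> nat. poisson_counts P (real n) S N \<longrightarrow>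
           (AE \<omega> in P. \<exists>M\<^sub>0. \<forall>M\<ge>M\<^sub>0. \<exists>t\<^sub>0\<ge>M. \<forall>t\<ge>t\<^sub>0.
            aggregate_A_inf (\<lambda>i j k. S i j k \<omega>) (\<lambda>i. N i \<omega>) \<inter> half_plane t
              = aggregate_B_inf (\<lambda>i j k. S i j k \<omega>) (\<lambda>i. N i \<omega>) M \<inter> half_plane t))"
proof -
  interpret prob_space P by fact
  have stable: "\<exists>M\<^sub>0. \<forall>M\<ge>M\<^sub>0. \<exists>t\<^sub>0\<ge>M. \<forall>t\<ge>t\<^sub>0.
      aggregate_A_inf W c \<inter> half_plane t = aggregate_B_inf W c M \<inter> half_plane t"
    if "\<forall>\<^sub>F m in sequentially. calm W c m" for W c
    using that aggregates_agree_if_calm unfolding eventually_sequentially by metis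
  have "AE \<omega> in P. \<forall>\<^sub>F m in sequentially. calm (\<lambda>i j k. S i j k \<omega>) (\<lambda>i. n) m"
  \<comment> \<open>The window has \<open>2 * m + 3\<close> levels with \<open>n\<close> particles
    each, hence the constant \<open>3 * n\<close>.\<close>
  proof (rule AE_eventually_calm[OF assms(2), where C = "3 * n"])
    show "indep_set (sets (vimage_algebra (space P) (\<lambda>\<omega> i. n) (\<Pi>\<^sub>M i\<in>UNIV. count_space UNIV)))
       (sets (vimage_algebra (space P) (\<lambda>\<omega>. \<lambda>(i, j)\<in>particles. \<lambda>k. S i j k \<omega>)
         (\<Pi>\<^sub>M p\<in>particles. path_space)))"
      by (rule indep_set_constant[OF walks_vimage_subset_events[OF assms(2)]])
    have "nat (3 + 2 * int m) = 3 + 2 * m" for m by simp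
    then have "(\<Sum>i\<in>{- int (Suc m)..int (Suc m)}. n) \<le> 3 * n * Suc m" for m
      by (simp add: algebra_simps)
    then show "AE \<omega> in P. \<forall>\<^sub>F m in sequentially.
        (\<Sum>i\<in>{- int (Suc m)..int (Suc m)}. n) \<le> 3 * n * Suc m"
      by (intro AE_I2 always_eventually allI)
  qed
  moreover have "AE \<omega> in P. \<forall>\<^sub>F m in sequentially. calm (\<lambda>i j k. S i j k \<omega>) (\<lambda>i. N i \<omega>) m"
    if N: "poisson_counts P (real n) S N" for N
  proof -
    obtain C where C: "AE \<omega> in P. \<forall>\<^sub>F m in sequentially.
        (\<Sum>i\<in>{- int (Suc m)..int (Suc m)}. N i \<omega>) \<le> C * Suc m"
      using poisson_counts_sum_le[OF N] assms(3) by auto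
    show ?thesis
      by (rule AE_eventually_calm[OF assms(2) _ C]) (use N in \<open>simp add: poisson_counts_def\<close>)
  qed
  ultimately show ?thesis
    by (blast intro: AE_mp[OF _ AE_I2] stable)
qed

end
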